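(* Let $\mathbf{k}$ be an algebraically closed field and let $A \subseteq \mathbf{k}[t,t^{-1},y]$ be an extending maximal $\mathbf{k}$-subalgebra. Then exactly one of the following cases occurs: (i) there exists an automorphism $\sigma$ of $\mathbf{k}[t,t^{-1},y]$ such that $\sigma(A)$ contains $\mathbf{k}[t,y]$; (ii) $A$ contains $\mathbf{k}[t,t^{-1}]$.
   Context: All rings are commutative with unity. A proper subring $A \subsetneq R$ is a maximal subring if there is no ring strictly between $A$ and $R$; a maximal $\mathbf{k}$-subalgebra is a maximal subring that is a $\mathbf{k}$-subalgebra. A maximal subring $A \subsetneq R$ is called extending if $\operatorname{Spec}(R) \to \operatorname{Spec}(A)$ is not surjective. Automorphisms are $\mathbf{k}$-algebra automorphisms. *)

theory Defs
  imports
    "HOL-Library.Poly_Mapping"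
    "HOL-Computational_Algebra.Polynomial"
    "HOL-Algebra.Ideal"
    "HOL-Algebra.QuotRing"
    "HOL-Algebra.Generated_Rings"
    "HOL-Algebra.Embedded_Algebras"
    "HOL-Algebra.Algebraic_Closure_Type"
begin

section \<open>Maximal subrings, subalgebras and automorphisms\<close>

definition maximal_subring :: "'a set \<Rightarrow> ('a, 'm) ring_scheme \<Rightarrow> bool" where
  "maximal_subring A R \<longleftrightarrow>
     subring A R \<and> A \<subset> carrier R \<and> \<not> (\<exists>B. subring B R \<and> A \<subset> B \<and> B \<subset> carrier R)"

text \<open>A \<^term>\<open>K\<close>-algebra structure on \<^term>\<open>R\<close> is given by the subring \<^term>\<open>K\<close> of scalars.
  The library predicate \<^const>\<open>subalgebra\<close> only says that \<^term>\<open>A\<close> is an additive subgroup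
  closed under scalars; closure under multiplication and the unit come from \<^const>\<open>subring\<close>.\<close>

definition maximal_subalgebra :: "'a set \<Rightarrow> 'a set \<Rightarrow> ('a, 'm) ring_scheme \<Rightarrow> bool" where
  "maximal_subalgebra K A R \<longleftrightarrow> maximal_subring A R \<and> subalgebra K A R"

definition Spec :: "('a, 'm) ring_scheme \<Rightarrow> 'a set set" where
  "Spec R = {P. primeideal P R}"

text \<open>The map \<open>Spec R \<rightarrow> Spec A\<close> induced by the inclusion is \<open>P \<mapsto> P \<inter> A\<close>
  (lemma \<open>Spec_contraction\<close> below shows that it is well defined).\<close>

definition extending :: "'a set \<Rightarrow> ('a, 'm) ring_scheme \<Rightarrow> bool" where
  "extending A R \<longleftrightarrow> (\<lambda>P. P \<inter> A) ` Spec R \<noteq> Spec (R\<lparr>carrier := A\<rparr>)"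

definition algebra_automorphisms :: "'a set \<Rightarrow> ('a, 'm) ring_scheme \<Rightarrow> ('a \<Rightarrow> 'a) set" where
  "algebra_automorphisms K R = {\<sigma> \<in> ring_iso R R. \<forall>c\<in>K. \<sigma> c = c}"

definition generated_subalgebra :: "'a set \<Rightarrow> ('a, 'm) ring_scheme \<Rightarrow> 'a set \<Rightarrow> 'a set" where
  "generated_subalgebra K R S = generate_ring R (K \<union> S)"

lemma Spec_contraction:
  assumes "cring R" "subring A R" "P \<in> Spec R"
  shows "P \<inter> A \<in> Spec (R\<lparr>carrier := A\<rparr>)"
proof -
  interpret R: cring R by fact
  interpret P: primeideal P R using assms(3) by (simp add: Spec_def)
  interpret A: cring "R\<lparr>carrier := A\<rparr>"
    using R.subcring_iff[OF subringE(1)[OF assms(2)]] R.subcringI'[OF assms(2)] by simp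
  have "A \<subseteq> carrier R" by (rule subringE(1)[OF assms(2)])
  then have sub: "a \<in> carrier R" if "a \<in> A" for a
    using that by blast
  interpret AR: ring_hom_ring "R\<lparr>carrier := A\<rparr>" R "\<lambda>x. x"
    by (rule ring_hom_ringI) (use sub A.ring_axioms R.ring_axioms in auto)
  have "ideal {r \<in> carrier (R\<lparr>carrier := A\<rparr>). r \<in> P} (R\<lparr>carrier := A\<rparr>)"
    by (rule AR.ideal_vimage) (rule P.is_ideal)
  also have "{r \<in> carrier (R\<lparr>carrier := A\<rparr>). r \<in> P} = P \<inter> A" by auto
  finally have I: "ideal (P \<inter> A) (R\<lparr>carrier := A\<rparr>)" .
  have "\<one>\<^bsub>R\<^esub> \<notin> P" using P.one_imp_carrier P.I_notcarr by auto
  moreover have "\<one>\<^bsub>R\<^esub> \<in> A" using subringE(3)[OF assms(2)] .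
  ultimately show ?thesis
    unfolding Spec_def using I A.cring_axioms
    by (auto intro!: primeidealI dest: P.I_prime[OF sub sub])
qed

section \<open>The ring \<open>\<^bold>k[t, t\<^sup>-\<^sup>1, y]\<close>\<close>

text \<open>Under convolution, finitely supported functions \<open>int \<Rightarrow>\<^sub>0 'k\<close> form the Laurent polynomial
  ring \<open>\<^bold>k[t, t\<^sup>-\<^sup>1]\<close>, with \<open>Poly_Mapping.single n c\<close> being \<open>c t\<^sup>n\<close>.\<close>

type_synonym 'k laurent_y = "(int \<Rightarrow>\<^sub>0 'k) poly"

abbreviation laurent_y_ring :: "'k::field laurent_y ring" where
  "laurent_y_ring \<equiv> ring_of_type_algebra"

definition scalars :: "'k::field laurent_y set" where
  "scalars = range (\<lambda>c. [:Poly_Mapping.single 0 c:])"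

definition var_t :: "'k::field laurent_y" where
  "var_t = [:Poly_Mapping.single 1 1:]"

definition var_t_inv :: "'k::field laurent_y" where
  "var_t_inv = [:Poly_Mapping.single (-1) 1:]"

definition var_y :: "'k::field laurent_y" where
  "var_y = [:0, 1:]"

lemma var_t_mult_inv: "(var_t :: 'k::field laurent_y) * var_t_inv = 1"
  by (simp add: var_t_def var_t_inv_def mult_single)

lemma generated_subalgebra_t_inv:
  "generated_subalgebra scalars laurent_y_ring {var_t, var_t_inv} =
     range (\<lambda>f :: int \<Rightarrow>\<^sub>0 'k::field. [:f:])" (is "?G = ?C")
proof
  interpret R: ring "laurent_y_ring :: 'k laurent_y ring" by (rule ring_from_type_algebra)
  have [simp]: "carrier (laurent_y_ring :: 'k laurent_y ring) = UNIV"
    by (simp add: ring_of_type_algebra_def)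
  have minus: "\<ominus>\<^bsub>laurent_y_ring\<^esub> x = - x" for x :: "'k laurent_y"
    by (rule R.minus_equality) (auto simp: ring_of_type_algebra_def)
  show "?G \<subseteq> ?C"
  proof
    fix x assume "x \<in> ?G"
    then show "x \<in> ?C"
      unfolding generated_subalgebra_def
    proof (induction rule: generate_ring.induct)
      case one
      show ?case by (auto simp: ring_of_type_algebra_def one_pCons)
    next
      case (a_inv h)
      then show ?case by (auto simp: minus)
    next
      case (eng_mult h1 h2)
      then show ?case by (auto simp: ring_of_type_algebra_def)
    qed (auto simp: ring_of_type_algebra_def scalars_def var_t_def var_t_inv_def)
  qed
  have one: "1 \<in> ?G"
    unfolding generated_subalgebra_def
    using generate_ring.one[of "laurent_y_ring :: 'k laurent_y ring"]
    by (simp add: ring_of_type_algebra_def)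
  have mult: "x * y \<in> ?G" if "x \<in> ?G" "y \<in> ?G" for x y
    using generate_ring.eng_mult[of x "laurent_y_ring :: 'k laurent_y ring" _ y] that
    unfolding generated_subalgebra_def by (simp add: ring_of_type_algebra_def)
  have add: "x + y \<in> ?G" if "x \<in> ?G" "y \<in> ?G" for x y
    using generate_ring.eng_add[of x "laurent_y_ring :: 'k laurent_y ring" _ y] that
    unfolding generated_subalgebra_def by (simp add: ring_of_type_algebra_def)
  have gen: "[:Poly_Mapping.single 0 c:] \<in> ?G" "var_t \<in> ?G" "var_t_inv \<in> ?G" for c
    unfolding generated_subalgebra_def by (auto intro!: generate_ring.incl simp: scalars_def)
  have pos: "[:Poly_Mapping.single (int n) 1:] \<in> ?G" for n
  proof (induction n)
    case (Suc n)
    have "[:Poly_Mapping.single (int (Suc n)) 1:] = var_t * ([:Poly_Mapping.single (int n) 1:] :: 'k laurent_y)"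
      by (simp add: var_t_def mult_single add.commute)
    with mult[OF gen(2) Suc.IH] show ?case by metis
  qed (use one in \<open>simp add: one_pCons flip: single_one\<close>)
  have neg: "[:Poly_Mapping.single (- int n) 1:] \<in> ?G" for n
  proof (induction n)
    case (Suc n)
    have "[:Poly_Mapping.single (- int (Suc n)) 1:] = var_t_inv * ([:Poly_Mapping.single (- int n) 1:] :: 'k laurent_y)"
      by (simp add: var_t_inv_def mult_single algebra_simps)
    with mult[OF gen(3) Suc.IH] show ?case by metis
  qed (use one in \<open>simp add: one_pCons flip: single_one\<close>)
  have unit: "[:Poly_Mapping.single i 1:] \<in> ?G" for i
    using pos neg by (cases i rule: int_cases2) auto
  have term_mem: "[:Poly_Mapping.single i c:] \<in> ?G" for i c
    using mult[OF gen(1)[of c] unit[of i]] by (simp add: mult_single)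
  have "[:f:] \<in> ?G" for f
  proof (induction f rule: update_induct)
    case const
    show ?case using term_mem[of 0 0] by simp
  next
    case (update f i c)
    then have "Poly_Mapping.update i c f = f + Poly_Mapping.single i c"
      by (intro poly_mapping_eqI)
         (auto simp: lookup_update lookup_add lookup_single when_def in_keys_iff)
    then show ?case
      using add[OF update.IH term_mem[of i c]] by simp
  qed
  then show "?C \<subseteq> ?G" by auto
qed

end

theory Submission
  imports Defs
begin

text \<open>If neither \<open>t\<close> nor \<open>t\<^sup>-\<^sup>1\<close> lies in \<open>A\<close>, then \<open>R = A[t] = A[t\<^sup>-\<^sup>1]\<close> by maximality.
  Chevalley's argument (as for the existence of valuation rings) then shows \<open>QR \<inter> A = Q\<close> for every
  prime \<open>Q\<close> of \<open>A\<close>, so \<open>Q\<close> is a contraction and \<open>A\<close> is not extending. Hence \<open>A\<close> contains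
  \<open>t\<close> or \<open>t\<^sup>-\<^sup>1\<close>. If it contains both, we are in case (ii). If it contains only \<open>t\<close>, then
  \<open>R = A[t\<^sup>-\<^sup>1]\<close> gives \<open>t\<^sup>N y \<in> A\<close> for some \<open>N\<close>, and \<open>y \<mapsto> t\<^sup>-\<^sup>N y\<close> is the required
  automorphism; if only \<open>t\<^sup>-\<^sup>1\<close>, compose with \<open>t \<mapsto> t\<^sup>-\<^sup>1\<close>. The cases exclude each other
  because automorphisms preserve units, and the units of \<open>R\<close> lie in \<open>\<^bold>k[t, t\<^sup>-\<^sup>1]\<close>: in both
  cases at once \<open>\<sigma>(A)\<close> would contain \<open>t\<close>, \<open>t\<^sup>-\<^sup>1\<close> and \<open>y\<close>.\<close>

section \<open>Ideals and subrings of a type-class ring\<close>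

lemma ring_of_type_algebra_simps [simp]:
  "carrier (ring_of_type_algebra :: 'a::comm_ring_1 ring) = UNIV"
  "x \<otimes>\<^bsub>(ring_of_type_algebra :: 'a ring)\<^esub> y = x * y"
  "x \<oplus>\<^bsub>(ring_of_type_algebra :: 'a ring)\<^esub> y = x + y"
  "\<one>\<^bsub>(ring_of_type_algebra :: 'a ring)\<^esub> = 1"
  "\<zero>\<^bsub>(ring_of_type_algebra :: 'a ring)\<^esub> = 0"
  by (simp_all add: ring_of_type_algebra_def)

lemma a_inv_ring_of_type_algebra [simp]:
  "\<ominus>\<^bsub>ring_of_type_algebra\<^esub> x = - (x :: 'a::comm_ring_1)"
proof -
  interpret R: ring "ring_of_type_algebra :: 'a ring" by (rule ring_from_type_algebra)
  show ?thesis by (rule R.minus_equality) auto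
qed

lemma subring_ring_of_type_algebra_iff:
  fixes A :: "'a::comm_ring_1 set"
  shows "subring A ring_of_type_algebra \<longleftrightarrow>
    1 \<in> A \<and> (\<forall>x\<in>A. - x \<in> A) \<and> (\<forall>x\<in>A. \<forall>y\<in>A. x * y \<in> A) \<and> (\<forall>x\<in>A. \<forall>y\<in>A. x + y \<in> A)"
    (is "?L \<longleftrightarrow> ?R")
proof
  assume ?L
  then show ?R using subringE[of A "ring_of_type_algebra :: 'a ring"] by simp
next
  interpret R: ring "ring_of_type_algebra :: 'a ring" by (rule ring_from_type_algebra)
  assume ?R
  then show ?L by (intro R.subringI) auto
qed

lemma ideal_ring_of_type_algebra_iff:
  fixes I :: "'a::comm_ring_1 set"
  shows "ideal I ring_of_type_algebra \<longleftrightarrow>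
    0 \<in> I \<and> (\<forall>x\<in>I. \<forall>y\<in>I. x + y \<in> I) \<and> (\<forall>x\<in>I. \<forall>r. r * x \<in> I)"
    (is "?L \<longleftrightarrow> ?R")
proof
  assume ?L
  then interpret I: ideal I "ring_of_type_algebra :: 'a ring" .
  have "x + y \<in> I" if "x \<in> I" "y \<in> I" for x y
    using additive_subgroup.a_closed[OF I.additive_subgroup_axioms that] by simp
  moreover have "r * x \<in> I" if "x \<in> I" for r x
    using I.I_l_closed[OF that, of r] by simp
  moreover have "0 \<in> I"
    using additive_subgroup.zero_closed[OF I.additive_subgroup_axioms] by simp
  ultimately show ?R by blast
next
  interpret R: ring "ring_of_type_algebra :: 'a ring" by (rule ring_from_type_algebra)
  assume R: ?R
  have "- x \<in> I" if "x \<in> I" for x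
  proof -
    have "(- 1) * x \<in> I" using R that by blast
    then show ?thesis by simp
  qed
  then have "subgroup I (add_monoid (ring_of_type_algebra :: 'a ring))"
    using R by (intro R.add.subgroupI) (auto simp flip: a_inv_def)
  then show ?L
    using R by (intro idealI R.ring_axioms) (auto simp: mult.commute)
qed

text \<open>Krull's argument: Zorn's lemma gives an ideal maximal among those containing
  \<open>J\<close> and missing the multiplicative set \<open>S\<close>, and such an ideal is
  prime.\<close>

lemma prime_ideal_avoiding:
  fixes J S :: "'a::comm_ring_1 set"
  assumes J: "ideal J ring_of_type_algebra" and JS: "J \<inter> S = {}"
    and one: "1 \<in> S" and mult: "\<And>x y. x \<in> S \<Longrightarrow> y \<in> S \<Longrightarrow> x * y \<in> S"
  obtains P where "primeideal P ring_of_type_algebra" "J \<subseteq> P" "P \<inter> S = {}"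
proof -
  define F where "F = {I. ideal I (ring_of_type_algebra :: 'a ring) \<and> J \<subseteq> I \<and> I \<inter> S = {}}"
  have "\<exists>M\<in>F. \<forall>L\<in>F. M \<subseteq> L \<longrightarrow> L = M"
  proof (rule subset_Zorn_nonempty)
    show "F \<noteq> {}" using J JS by (auto simp: F_def)
    fix C assume C: "C \<noteq> {}" "subset.chain F C"
    then have CF: "C \<subseteq> F" and lin: "\<And>L H. L \<in> C \<Longrightarrow> H \<in> C \<Longrightarrow> L \<subseteq> H \<or> H \<subseteq> L"
      by (auto simp: subset_chain_def)
    have "x + y \<in> \<Union>C" if xy: "x \<in> \<Union>C" "y \<in> \<Union>C" for x y
    proof -
      from xy obtain L H where GH: "L \<in> C" "H \<in> C" "x \<in> L" "y \<in> H" by blast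
      then obtain K where "K \<in> C" "x \<in> K" "y \<in> K"
        using lin[of L H] by blast
      then show ?thesis
        using CF unfolding F_def ideal_ring_of_type_algebra_iff by blast
    qed
    moreover have "r * x \<in> \<Union>C" if "x \<in> \<Union>C" for r x
      using that CF unfolding F_def ideal_ring_of_type_algebra_iff by blast
    moreover have "0 \<in> \<Union>C"
      using C(1) CF unfolding F_def ideal_ring_of_type_algebra_iff by blast
    ultimately have "ideal (\<Union>C) (ring_of_type_algebra :: 'a ring)"
      unfolding ideal_ring_of_type_algebra_iff by blast
    then show "\<Union>C \<in> F"
      using CF C(1) by (auto simp: F_def)
  qed
  then obtain P where PF: "P \<in> F" and max: "\<And>L. L \<in> F \<Longrightarrow> P \<subseteq> L \<Longrightarrow> L = P" by blast
  from PF have P: "ideal P (ring_of_type_algebra :: 'a ring)" "J \<subseteq> P" "P \<inter> S = {}"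
    by (auto simp: F_def)
  note P' = P(1)[unfolded ideal_ring_of_type_algebra_iff]
  \<comment> \<open>The ideal \<open>P + Ra\<close> is strictly larger than \<open>P\<close>, so by
    maximality it must meet \<open>S\<close>.\<close>
  have meets: "\<exists>p r. p \<in> P \<and> p + r * a \<in> S" if a: "a \<notin> P" for a
  proof (rule ccontr)
    assume none: "\<not> ?thesis"
    define L where "L = {p + r * a |p r. p \<in> P}"
    have "P \<subseteq> L"
    proof
      fix p assume "p \<in> P"
      then have "p + 0 * a \<in> L" unfolding L_def by blast
      then show "p \<in> L" by simp
    qed
    have add: "x + y \<in> L" if xy: "x \<in> L" "y \<in> L" for x y
    proof -
      from xy obtain p r q s where "x = p + r * a" "y = q + s * a" "p \<in> P" "q \<in> P"
        unfolding L_def by blast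
      moreover from this have "x + y = (p + q) + (r + s) * a" "p + q \<in> P"
        using P' by (auto simp: algebra_simps)
      ultimately show ?thesis unfolding L_def by blast
    qed
    have smult: "c * x \<in> L" if x: "x \<in> L" for x c
    proof -
      from x obtain p r where "x = p + r * a" "p \<in> P" unfolding L_def by blast
      moreover from this have "c * x = c * p + (c * r) * a" "c * p \<in> P"
        using P' by (auto simp: algebra_simps)
      ultimately show ?thesis unfolding L_def by blast
    qed
    have "ideal L (ring_of_type_algebra :: 'a ring)"
      unfolding ideal_ring_of_type_algebra_iff using add smult \<open>P \<subseteq> L\<close> P' by blast
    then have "L \<in> F"
      using none \<open>P \<subseteq> L\<close> P(2) by (auto simp: F_def L_def)
    then have "L = P" using \<open>P \<subseteq> L\<close> max by blast
    moreover have "0 + 1 * a \<in> L" unfolding L_def using P' by blast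
    ultimately show False using a by simp
  qed
  have "primeideal P (ring_of_type_algebra :: 'a ring)"
  proof (rule primeidealI[OF P(1) cring_from_type_algebra])
    show "carrier ring_of_type_algebra \<noteq> P" using P(3) one by auto
    fix a b :: 'a
    assume "a \<otimes>\<^bsub>ring_of_type_algebra\<^esub> b \<in> P"
    then have ab: "a * b \<in> P" by simp
    show "a \<in> P \<or> b \<in> P"
    proof (rule ccontr)
      assume "\<not> ?thesis"
      then obtain p r q s where pq: "p \<in> P" "q \<in> P" "p + r * a \<in> S" "q + s * b \<in> S"
        using meets by metis
      \<comment> \<open>The product of two elements of \<open>S\<close> lies in \<open>S\<close>,
        while every term of its expansion has a factor \<open>p\<close>, \<open>q\<close> or
        \<open>a * b\<close> in \<open>P\<close>.\<close>
      have "(p + r * a) * (q + s * b) = (q + s * b) * p + ((r * a) * q + (r * s) * (a * b))"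
        by (simp add: algebra_simps)
      also have "\<dots> \<in> P" using P' pq ab by blast
      finally show False using mult[OF pq(3,4)] P(3) by blast
    qed
  qed
  then show ?thesis using that P by blast
qed

section \<open>Chevalley's argument\<close>

text \<open>Infinite descent on the sum of the degrees: the relation of smaller degree lowers the
  degree of the other one. Admitting any value in \<open>A - Q\<close>, not just 1, spares
  localising \<open>A\<close> at \<open>Q\<close>.\<close>

lemma unit_relations_contradiction:
  fixes A Q :: "'a::comm_ring_1 set"
  assumes A: "subring A ring_of_type_algebra"
    and QA: "Q \<subseteq> A" and Q0: "0 \<in> Q"
    and Qadd: "\<And>x y. x \<in> Q \<Longrightarrow> y \<in> Q \<Longrightarrow> x + y \<in> Q"
    and Qmult: "\<And>x a. x \<in> Q \<Longrightarrow> a \<in> A \<Longrightarrow> a * x \<in> Q"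
    and Qprime: "\<And>x y. x \<in> A \<Longrightarrow> y \<in> A \<Longrightarrow> x * y \<in> Q \<Longrightarrow> x \<in> Q \<or> y \<in> Q"
  shows "s * t = 1 \<Longrightarrow> (\<And>i. coeff p i \<in> Q) \<Longrightarrow> (\<And>i. coeff q i \<in> Q) \<Longrightarrow>
    poly p t \<in> A - Q \<Longrightarrow> poly q s \<in> A - Q \<Longrightarrow> False"
proof (induction "degree p + degree q" arbitrary: p q s t rule: less_induct)
  case less
  note A' = A[unfolded subring_ring_of_type_algebra_iff]
  \<comment> \<open>One descent step when \<open>q\<close> has the smaller degree. The opposite case
    follows by exchanging \<open>(p, t)\<close> with \<open>(q, s)\<close>.\<close>
  have step: False
    if st: "s * t = 1" and p: "\<And>i. coeff p i \<in> Q" and q: "\<And>i. coeff q i \<in> Q"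
      and pt: "poly p t \<in> A - Q" and qs: "poly q s \<in> A - Q"
      and le: "degree q \<le> degree p"
      and IH: "\<And>p'. degree p' < degree p \<Longrightarrow> (\<And>i. coeff p' i \<in> Q) \<Longrightarrow> poly p' t \<in> A - Q \<Longrightarrow> False"
    for p q s t
  proof -
    define n where "n = degree p"
    obtain q0 q1 where q_eq: "q = pCons q0 q1" by (cases q)
    have q0: "q0 \<in> Q" using q[of 0] by (simp add: q_eq)
    have q1: "coeff q1 i \<in> Q" for i using q[of "Suc i"] by (simp add: q_eq)
    \<comment> \<open>Otherwise the value of \<open>q\<close> would be \<open>q0\<close>, an element
      of \<open>Q\<close>. Hence \<open>n\<close> is positive and no exponent
      \<open>n - 1 - j\<close> below is truncated.\<close>
    have "q1 \<noteq> 0" using qs q0 by (auto simp: q_eq)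
    then have d: "Suc (degree q1) \<le> n" using le by (simp add: q_eq n_def)
    \<comment> \<open>In the local case \<open>w\<close> would be the unit \<open>1 - q0\<close>.
      Here it is only in \<open>A - Q\<close>, so \<open>p\<close> is multiplied by \<open>w\<close>
      instead of being divided by it.\<close>
    define w where "w = poly q s - q0"
    have w: "w = s * poly q1 s" by (simp add: w_def q_eq)
    have wA: "w \<in> A" using qs q0 QA A' by (metis DiffD1 diff_conv_add_uminus subsetD w_def)
    have wQ: "w \<notin> Q" using qs q0 Qadd[of w q0] by (auto simp: w_def)
    \<comment> \<open>The top term \<open>c t\<^sup>n\<close> of \<open>p(t)\<close>, times \<open>w\<close>, has degree below \<open>n\<close> because \<open>w t\<^sup>n = r(t)\<close>.\<close>
    define r where "r = (\<Sum>j\<le>degree q1. monom (coeff q1 j) (n - 1 - j))"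
    have ts: "s ^ j * t ^ j = 1" for j
      using st by (metis power_mult_distrib power_one)
    have "poly r t = (\<Sum>j\<le>degree q1. coeff q1 j * t ^ (n - 1 - j))"
      by (simp add: r_def poly_sum poly_monom)
    also have "\<dots> = (\<Sum>j\<le>degree q1. coeff q1 j * s ^ j * t ^ (n - 1))"
    proof (rule sum.cong)
      fix j assume "j \<in> {..degree q1}"
      then have "t ^ (n - 1) = t ^ j * t ^ (n - 1 - j)"
        using d by (simp flip: power_add)
      then have "s ^ j * t ^ (n - 1) = t ^ (n - 1 - j)"
        using ts[of j] by (metis mult.assoc mult_1)
      then show "coeff q1 j * t ^ (n - 1 - j) = coeff q1 j * s ^ j * t ^ (n - 1)"
        by (simp add: mult.assoc)
    qed simp
    also have "\<dots> = poly q1 s * t ^ (n - 1)"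
      by (simp add: poly_altdef sum_distrib_right)
    also have "\<dots> = w * t ^ n"
    proof -
      have "t ^ n = t * t ^ (n - 1)" using d by (metis Suc_le_D diff_Suc_1 power_Suc)
      then have "w * t ^ n = (s * t) * (poly q1 s * t ^ (n - 1))"
        unfolding w by (simp only: mult_ac)
      then show ?thesis using st by simp
    qed
    finally have rt: "poly r t = w * t ^ n" .
    define c where "c = coeff p n"
    \<comment> \<open>The term \<open>c t^n\<close> of \<open>p\<close>, times \<open>w\<close>, is
      traded for \<open>c * r\<close>. The value becomes \<open>w * poly p t\<close>, which
      primeness keeps outside \<open>Q\<close>.\<close>
    define p' where "p' = smult w (p - monom c n) + smult c r"
    have p't: "poly p' t = w * poly p t"
      by (simp add: p'_def rt poly_monom algebra_simps)
    have sumQ: "(\<Sum>j\<in>J. f j) \<in> Q" if "\<And>j. f j \<in> Q" for f :: "nat \<Rightarrow> 'a" and J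
      by (induction J rule: infinite_finite_induct) (auto simp: Q0 Qadd that)
    have rQ: "coeff r i \<in> Q" for i
      unfolding r_def coeff_sum by (rule sumQ) (simp add: q1 Q0)
    have "coeff p' i \<in> Q" for i
    proof -
      have "coeff (p - monom c n) i \<in> Q" using p Q0 by (simp add: c_def)
      then show ?thesis
        using Qadd[OF Qmult[OF _ wA] Qmult[OF rQ[of i], of c]] p[of n] QA
        by (auto simp: p'_def c_def simp del: coeff_diff)
    qed
    moreover have "poly p' t \<in> A - Q"
      unfolding p't using pt wA wQ A' Qprime by blast
    moreover have "degree p' < degree p"
    proof -
      have "coeff p' i = 0" if "i \<ge> n" for i
      proof -
        have "coeff r i = 0"
          unfolding r_def coeff_sum using that d by (intro sum.neutral) auto
        moreover have "coeff (p - monom c n) i = 0"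
          using that by (cases "i = n") (auto simp: c_def n_def coeff_eq_0)
        ultimately show ?thesis by (simp add: p'_def)
      qed
      then have "degree p' \<le> n - 1"
        using d by (intro degree_le) auto
      then show ?thesis using d by (simp add: n_def)
    qed
    ultimately show False using IH by blast
  qed
  show False
  proof (cases "degree q \<le> degree p")
    case True
    show False
      by (rule step[OF less.prems True]) (rule less.hyps[OF _ less.prems(1) _ less.prems(3) _ less.prems(5)], auto)
  next
    case False
    have ts: "t * s = 1" using less.prems(1) by (simp add: mult.commute)
    show False
      by (rule step[OF ts less.prems(3,2,5,4)])
        (use False in simp, rule less.hyps[OF _ less.prems(1,2) _ less.prems(4)], auto)
  qed
qed

section \<open>Polynomial values over a subring, and adjoining an element to a maximal
  subring\<close>

lemma poly_in_subring:
  fixes A :: "'a::comm_ring_1 set"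
  assumes A: "subring A ring_of_type_algebra" and "x \<in> A"
  shows "(\<And>i. coeff p i \<in> A) \<Longrightarrow> poly p x \<in> A"
proof (induction p)
  case 0
  show ?case using subringE(2)[OF A] by simp
next
  case (pCons a p)
  have "coeff p i \<in> A" for i using pCons.prems[of "Suc i"] by simp
  moreover have "a \<in> A" using pCons.prems[of 0] by simp
  ultimately show ?case
    using A pCons.IH \<open>x \<in> A\<close> by (auto simp: subring_ring_of_type_algebra_iff)
qed

text \<open>The values at \<open>t\<close> of polynomials over \<open>A\<close> form a subring
  strictly larger than \<open>A\<close>, so maximality makes it the whole ring.\<close>

lemma maximal_subring_adjoin:
  fixes A :: "'a::comm_ring_1 set"
  assumes max: "maximal_subring A ring_of_type_algebra" and t: "t \<notin> A"
  obtains p where "\<And>i. coeff p i \<in> A" "z = poly p t"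
proof -
  have A: "subring A ring_of_type_algebra"
    using max by (simp add: maximal_subring_def)
  note A' = A[unfolded subring_ring_of_type_algebra_iff]
  have zero: "0 \<in> A" using subringE(2)[OF A] by simp
  define B where "B = {poly p t |p. \<forall>i. coeff p i \<in> A}"
  have sumA: "(\<Sum>j\<in>J. f j) \<in> A" if "\<And>j. f j \<in> A" for f :: "nat \<Rightarrow> 'a" and J
    by (induction J rule: infinite_finite_induct) (auto simp: zero A' that)
  have B: "poly p t \<in> B" if "\<And>i. coeff p i \<in> A" for p using that by (auto simp: B_def)
  have sub: "A \<subseteq> B"
  proof
    fix a assume "a \<in> A"
    then show "a \<in> B" using B[of "[:a:]"] zero by (simp add: coeff_pCons split: nat.split)
  qed
  have "t \<in> B" using B[of "[:0, 1:]"] zero A' by (simp add: coeff_pCons split: nat.split)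
  have add: "x + y \<in> B" if "x \<in> B" "y \<in> B" for x y
    using that A' B by (auto simp: B_def simp flip: poly_add)
  have mult: "x * y \<in> B" if xy: "x \<in> B" "y \<in> B" for x y
  proof -
    from xy obtain p q where pq: "x = poly p t" "y = poly q t" "\<And>i. coeff p i \<in> A" "\<And>i. coeff q i \<in> A"
      by (auto simp: B_def)
    then have "coeff (p * q) i \<in> A" for i
      unfolding coeff_mult by (intro sumA) (auto simp: A')
    then show ?thesis using B[of "p * q"] pq by simp
  qed
  have minus: "- x \<in> B" if "x \<in> B" for x
  proof -
    have "- 1 \<in> B" using sub A' by blast
    then show ?thesis using mult[of "- 1" x] that by simp
  qed
  have "subring B ring_of_type_algebra"
    unfolding subring_ring_of_type_algebra_iff using add mult minus sub A' by blast
  moreover have "A \<subset> B" using sub \<open>t \<in> B\<close> t by blast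
  ultimately have "B = UNIV" using max by (auto simp: maximal_subring_def)
  then show ?thesis using that by (auto simp: B_def)
qed

lemma maximal_extending_mem_or_inverse_mem:
  fixes A :: "'a::comm_ring_1 set"
  assumes max: "maximal_subring A ring_of_type_algebra"
    and ext: "extending A ring_of_type_algebra"
    and st: "s * t = 1"
  shows "t \<in> A \<or> s \<in> A"
proof (rule ccontr)
  assume "\<not> ?thesis"
  then have t: "t \<notin> A" and s: "s \<notin> A" by auto
  let ?R = "ring_of_type_algebra :: 'a ring"
  have A: "subring A ?R" using max by (simp add: maximal_subring_def)
  note A' = A[unfolded subring_ring_of_type_algebra_iff]
  \<comment> \<open>Contractions of primes are always primes of \<open>A\<close>, so inequality of
    the two sets means that some prime \<open>Q\<close> of \<open>A\<close> is missed.\<close>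
  obtain Q where Q: "primeideal Q (?R\<lparr>carrier := A\<rparr>)" and nc: "\<And>P. primeideal P ?R \<Longrightarrow> P \<inter> A \<noteq> Q"
    using ext Spec_contraction[OF cring_from_type_algebra A] unfolding extending_def
    by (auto simp: Spec_def)
  interpret Q: primeideal Q "?R\<lparr>carrier := A\<rparr>" by (rule Q)
  have QA: "Q \<subseteq> A" using Q.a_subset by simp
  have Q0: "0 \<in> Q" using additive_subgroup.zero_closed[OF Q.additive_subgroup_axioms] by simp
  have Qadd: "x + y \<in> Q" if "x \<in> Q" "y \<in> Q" for x y using additive_subgroup.a_closed[OF Q.additive_subgroup_axioms] that by simp
  have Qmult: "a * x \<in> Q" if "x \<in> Q" "a \<in> A" for x a using Q.I_l_closed that by simp
  have Qprime: "x \<in> Q \<or> y \<in> Q" if "x \<in> A" "y \<in> A" "x * y \<in> Q" for x y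
    using Q.I_prime[of x y] that by simp
  have oneQ: "1 \<notin> Q" using Q.one_imp_carrier Q.I_notcarr by auto
  have sumQ: "(\<Sum>j\<in>J. f j) \<in> Q" if "\<And>j. f j \<in> Q" for f :: "nat \<Rightarrow> 'a" and J
    by (induction J rule: infinite_finite_induct) (auto simp: Q0 Qadd that)
  \<comment> \<open>Since \<open>R = A[u]\<close>, the extension \<open>QR\<close> is the set of values at \<open>u\<close> of polynomials over \<open>Q\<close>.
    If it did not meet \<open>A - Q\<close>, then \<open>Q\<close> would be a contraction.\<close>
  have rel: "\<exists>p. (\<forall>i. coeff p i \<in> Q) \<and> poly p u \<in> A - Q" if u: "u \<notin> A" for u
  proof (rule ccontr)
    assume none: "\<not> ?thesis"
    define J where "J = {poly p u |p. \<forall>i. coeff p i \<in> Q}"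
    have J: "poly p u \<in> J" if "\<And>i. coeff p i \<in> Q" for p using that by (auto simp: J_def)
    have "0 \<in> J" using J[of 0] Q0 by simp
    moreover have "x + y \<in> J" if "x \<in> J" "y \<in> J" for x y
      using that Qadd J by (auto simp: J_def simp flip: poly_add)
    \<comment> \<open>Here \<open>r\<close> is any ring element. Writing it as a polynomial in
      \<open>u\<close> over \<open>A\<close> brings the coefficients of the product into
      \<open>Q\<close>.\<close>
    moreover have "r * x \<in> J" if x: "x \<in> J" for x r
    proof -
      obtain p where p: "\<And>i. coeff p i \<in> A" "r = poly p u"
        using maximal_subring_adjoin[OF max u] by blast
      obtain q where q: "x = poly q u" "\<And>i. coeff q i \<in> Q" using x by (auto simp: J_def)
      have "coeff (p * q) i \<in> Q" for i
        unfolding coeff_mult by (intro sumQ) (auto simp: p q Qmult)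
      then show ?thesis using J[of "p * q"] p q by simp
    qed
    ultimately have "ideal J ?R" by (simp add: ideal_ring_of_type_algebra_iff)
    moreover have "J \<inter> (A - Q) = {}" using none by (auto simp: J_def)
    moreover have "1 \<in> A - Q" using A' oneQ by blast
    moreover have "x * y \<in> A - Q" if "x \<in> A - Q" "y \<in> A - Q" for x y
      using that A' Qprime by blast
    ultimately obtain P where P: "primeideal P ?R" "J \<subseteq> P" "P \<inter> (A - Q) = {}"
      by (rule prime_ideal_avoiding)
    have "Q \<subseteq> J"
    proof
      fix a assume "a \<in> Q"
      then show "a \<in> J" using J[of "[:a:]"] Q0 by (simp add: coeff_pCons split: nat.split)
    qed
    then have "P \<inter> A = Q" using P QA by blast
    then show False using nc P(1) by blast
  qed
  obtain p q where "\<And>i. coeff p i \<in> Q" "poly p t \<in> A - Q" "\<And>i. coeff q i \<in> Q" "poly q s \<in> A - Q"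
    using rel[OF t] rel[OF s] by blast
  then show False
    using unit_relations_contradiction[OF A QA Q0 Qadd Qmult Qprime st] by blast
qed

text \<open>Every \<open>z\<close> is a polynomial in \<open>s\<close> over \<open>A\<close>, and a
  high power of \<open>t\<close> clears all powers of \<open>s\<close>.\<close>

lemma power_mult_mem_of_inverse_notin:
  fixes A :: "'a::comm_ring_1 set"
  assumes max: "maximal_subring A ring_of_type_algebra"
    and st: "s * t = 1" and t: "t \<in> A" and s: "s \<notin> A"
  obtains N where "t ^ N * z \<in> A"
proof -
  have A: "subring A ring_of_type_algebra" using max by (simp add: maximal_subring_def)
  have "(\<And>i. coeff p i \<in> A) \<Longrightarrow> \<exists>N. t ^ N * poly p s \<in> A" for p
  proof (induction p)
    case 0
    show ?case using subringE(2)[OF A] by simp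
  next
    case (pCons a p)
    have "coeff p i \<in> A" for i using pCons.prems[of "Suc i"] by simp
    then obtain N where N: "t ^ N * poly p s \<in> A" using pCons.IH by blast
    have a: "a \<in> A" using pCons.prems[of 0] by simp
    \<comment> \<open>The one extra factor \<open>t\<close> cancels the \<open>s\<close> that
      \<open>pCons\<close> puts in front of \<open>p\<close>.\<close>
    have "t ^ Suc N \<in> A"
      using t A by (induction N) (auto simp: subring_ring_of_type_algebra_iff)
    moreover have "t ^ Suc N * poly (pCons a p) s = t ^ Suc N * a + (s * t) * (t ^ N * poly p s)"
      by (simp add: algebra_simps)
    ultimately have "t ^ Suc N * poly (pCons a p) s \<in> A"
      using N a A st by (auto simp: subring_ring_of_type_algebra_iff)
    then show ?case by blast
  qed
  moreover obtain p where "\<And>i. coeff p i \<in> A" "z = poly p s"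
    using maximal_subring_adjoin[OF max s, of z] by blast
  ultimately show ?thesis using that by blast
qed

section \<open>Automorphisms of the Laurent polynomial ring in y\<close>

text \<open>This is the substitution of \<open>u * y\<close> for \<open>y\<close>. Since
  \<open>u\<close> is a unit, substituting \<open>v * y\<close> inverts it.\<close>

lemma pcompose_scale_automorphism:
  fixes u v :: "int \<Rightarrow>\<^sub>0 'k::field"
  assumes uv: "u * v = 1"
  shows "(\<lambda>p. p \<circ>\<^sub>p [:0, u:]) \<in> algebra_automorphisms scalars laurent_y_ring"
proof -
  have inv: "(p \<circ>\<^sub>p [:0, a:]) \<circ>\<^sub>p [:0, b:] = p" if "a * b = 1" for a b and p :: "'k laurent_y"
  proof -
    have "[:0, a:] \<circ>\<^sub>p [:0, b:] = [:0, 1:]"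
      using that by (simp add: pcompose_pCons mult.commute)
    then show ?thesis by (simp flip: pcompose_assoc)
  qed
  have "bij (\<lambda>p :: 'k laurent_y. p \<circ>\<^sub>p [:0, u:])"
    by (rule o_bij[where g = "\<lambda>p. p \<circ>\<^sub>p [:0, v:]"])
      (use uv inv[of u v] inv[of v u] in \<open>auto simp: fun_eq_iff mult.commute\<close>)
  then show ?thesis
    by (auto simp: algebra_automorphisms_def ring_iso_def ring_hom_def scalars_def
        pcompose_mult pcompose_add pcompose_1)
qed

text \<open>The involution exchanging \<open>t\<close> and its inverse. Negation is its own inverse,
  so pulling exponents back along it, as \<open>map_key\<close> does, also pushes them
  forward.\<close>

definition laurent_flip :: "(int \<Rightarrow>\<^sub>0 'k::field) \<Rightarrow> (int \<Rightarrow>\<^sub>0 'k)" where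
  "laurent_flip = Poly_Mapping.map_key uminus"

lemma laurent_flip_single [simp]:
  "laurent_flip (Poly_Mapping.single i c) = Poly_Mapping.single (- i) c"
  using map_key_single[of uminus "- i" c] by (simp add: laurent_flip_def)

lemma laurent_flip_add: "laurent_flip (f + g) = laurent_flip f + laurent_flip g"
  by (simp add: laurent_flip_def map_key_plus)

lemma laurent_flip_0 [simp]: "laurent_flip 0 = 0"
  by (simp add: laurent_flip_def)

lemma laurent_flip_1 [simp]: "laurent_flip 1 = 1"
  by (simp flip: single_one)

lemma laurent_flip_flip [simp]: "laurent_flip (laurent_flip f) = f"
  by (rule poly_mapping_eqI) (simp add: laurent_flip_def map_key.rep_eq)

text \<open>A sum of monomials is built by addition rather than by updates, which suits additive
  maps.\<close>

lemma laurent_induct [case_names zero add_single]: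
  fixes f :: "int \<Rightarrow>\<^sub>0 'k::field"
  assumes "P 0" "\<And>f i c. P f \<Longrightarrow> P (f + Poly_Mapping.single i c)"
  shows "P f"
proof (induction f rule: update_induct)
  case (update f i c)
  then have "Poly_Mapping.update i c f = f + Poly_Mapping.single i c"
    by (intro poly_mapping_eqI) (auto simp: lookup_update lookup_add lookup_single when_def in_keys_iff)
  then show ?case using assms(2) update by simp
qed (rule assms(1))

lemma laurent_flip_mult: "laurent_flip (f * g) = laurent_flip f * laurent_flip g"
proof (induction f rule: laurent_induct)
  case (add_single f i c)
  have "laurent_flip (Poly_Mapping.single i c * g) = Poly_Mapping.single (- i) c * laurent_flip g"
    by (induction g rule: laurent_induct) (auto simp: algebra_simps laurent_flip_add mult_single)
  with add_single show ?case by (simp add: distrib_right laurent_flip_add)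
qed simp

text \<open>The flip acts on coefficients and leaves \<open>y\<close> alone. Being an involution, it
  is bijective.\<close>

lemma map_poly_laurent_flip_automorphism:
  "map_poly laurent_flip \<in> algebra_automorphisms (scalars :: 'k::field laurent_y set) laurent_y_ring"
proof -
  let ?m = "map_poly laurent_flip :: 'k laurent_y \<Rightarrow> 'k laurent_y"
  have sum: "laurent_flip (\<Sum>j\<in>J. f j) = (\<Sum>j\<in>J. laurent_flip (f j))"
    for f :: "nat \<Rightarrow> int \<Rightarrow>\<^sub>0 'k" and J
    by (induction J rule: infinite_finite_induct) (auto simp: laurent_flip_add)
  have "?m (?m p) = p" for p by (intro poly_eqI) (simp add: coeff_map_poly)
  then have "bij ?m" by (intro o_bij[where g = ?m]) (auto simp: fun_eq_iff)
  moreover have "?m (p * q) = ?m p * ?m q" for p q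
    by (intro poly_eqI) (simp add: coeff_map_poly coeff_mult sum laurent_flip_mult)
  moreover have "?m (p + q) = ?m p + ?m q" for p q
    by (intro poly_eqI) (simp add: coeff_map_poly laurent_flip_add)
  moreover have "?m 1 = 1" by (simp add: one_pCons map_poly_pCons)
  ultimately show ?thesis
    by (auto simp: algebra_automorphisms_def ring_iso_def ring_hom_def scalars_def map_poly_pCons)
qed

lemma algebra_automorphisms_comp:
  assumes "\<sigma> \<in> algebra_automorphisms K R" "\<tau> \<in> algebra_automorphisms K R"
  shows "\<tau> \<circ> \<sigma> \<in> algebra_automorphisms K R"
  using assms ring_iso_set_trans by (fastforce simp: algebra_automorphisms_def)

text \<open>The image of \<open>A\<close> is again a subring, and it contains the scalars because
  \<open>\<sigma>\<close> fixes them. With \<open>\<sigma> = id\<close> this is a statement about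
  \<open>A\<close> itself.\<close>

lemma generated_subalgebra_subset_image:
  fixes A :: "'k::field laurent_y set"
  assumes \<sigma>: "\<sigma> \<in> algebra_automorphisms scalars laurent_y_ring"
    and A: "subring A laurent_y_ring" "scalars \<subseteq> A" and S: "S \<subseteq> \<sigma> ` A"
  shows "generated_subalgebra scalars laurent_y_ring S \<subseteq> \<sigma> ` A"
proof -
  have hom: "\<sigma> (x * y) = \<sigma> x * \<sigma> y" "\<sigma> (x + y) = \<sigma> x + \<sigma> y" "\<sigma> 1 = 1" for x y
    using \<sigma> by (auto simp: algebra_automorphisms_def ring_iso_def ring_hom_def)
  have minus: "- \<sigma> x = \<sigma> (- x)" for x
  proof (rule minus_unique)
    have "\<sigma> 0 = 0" using hom(2)[of 0 0] by (metis add_0 add_cancel_right_right)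
    then show "\<sigma> x + \<sigma> (- x) = 0" using hom(2)[of x "- x"] by simp
  qed
  have sc: "\<sigma> c = c" if "c \<in> scalars" for c
    using \<sigma> that by (auto simp: algebra_automorphisms_def)
  have "\<sigma> 1 \<in> \<sigma> ` A"
    using A(1) unfolding subring_ring_of_type_algebra_iff by blast
  then have "1 \<in> \<sigma> ` A" by (simp only: hom(3))
  moreover have "\<And>x. x \<in> \<sigma> ` A \<Longrightarrow> - x \<in> \<sigma> ` A"
      "\<And>x y. x \<in> \<sigma> ` A \<Longrightarrow> y \<in> \<sigma> ` A \<Longrightarrow> x * y \<in> \<sigma> ` A \<and> x + y \<in> \<sigma> ` A"
    using A(1) by (auto simp: subring_ring_of_type_algebra_iff minus simp flip: hom(1,2))
  moreover have "scalars \<subseteq> \<sigma> ` A" using A(2) sc by (metis image_eqI subset_eq)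
  moreover have "x \<in> \<sigma> ` A" if "x \<in> generate_ring laurent_y_ring (scalars \<union> S)" for x
    using that by induction (use calculation S in auto)
  ultimately show ?thesis by (auto simp: generated_subalgebra_def)
qed

text \<open>Treats both choices of the unit in \<open>A\<close> at once: \<open>\<tau>\<close>
  carries that unit to \<open>var_t\<close>, as the identity or as the flip.\<close>

lemma exists_automorphism:
  fixes A :: "'k::field laurent_y set"
  assumes max: "maximal_subring A laurent_y_ring" and sc: "scalars \<subseteq> A"
    and \<tau>: "\<tau> \<in> algebra_automorphisms scalars laurent_y_ring"
    and st: "s * t = 1" "[:t:] \<in> A" "[:s:] \<notin> A"
    and tau: "\<tau> [:t:] = var_t" "\<tau> var_y = var_y"
  shows "\<exists>\<sigma> \<in> algebra_automorphisms scalars laurent_y_ring.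
    generated_subalgebra scalars laurent_y_ring {var_t, var_y} \<subseteq> \<sigma> ` A"
proof -
  have "[:s:] * [:t:] = 1" using st(1) by (simp add: one_pCons mult.commute)
  then obtain N where "[:t:] ^ N * var_y \<in> A"
    using power_mult_mem_of_inverse_notin[OF max _ st(2,3)] by blast
  moreover have "[:t:] ^ n = [:t ^ n:]" for n by (induction n) (auto simp: one_pCons)
  ultimately have y: "[:0, t ^ N:] \<in> A" by (simp add: var_y_def)
  have ts: "s ^ N * t ^ N = 1" using st(1) by (metis power_mult_distrib power_one)
  \<comment> \<open>\<open>\<rho>\<close> fixes the coefficients and sends \<open>t^N * y\<close>,
    known to lie in \<open>A\<close>, to \<open>y\<close>.\<close>
  define \<rho> where "\<rho> = (\<lambda>p :: 'k laurent_y. p \<circ>\<^sub>p [:0, s ^ N:])"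
  have "\<tau> \<circ> \<rho> \<in> algebra_automorphisms scalars laurent_y_ring"
    unfolding \<rho>_def using pcompose_scale_automorphism[OF ts] \<tau> by (rule algebra_automorphisms_comp)
  moreover have "(\<tau> \<circ> \<rho>) [:t:] = var_t" by (simp add: \<rho>_def tau)
  moreover have "(\<tau> \<circ> \<rho>) [:0, t ^ N:] = var_y"
    using tau(2) ts by (simp add: \<rho>_def pcompose_pCons var_y_def mult.commute)
  ultimately show ?thesis
    using generated_subalgebra_subset_image[OF _ _ sc, of "\<tau> \<circ> \<rho>" "{var_t, var_y}"] max st(2) y
    unfolding maximal_subring_def by (metis empty_subsetI image_eqI insert_subset)
qed

text \<open>The equivalence with a negation encodes "exactly one": left to right is exclusivity,
  right to left is exhaustiveness.\<close>

theorem theorem1p0p5: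
  fixes A :: "'k::alg_closed_field laurent_y set"
  assumes "maximal_subalgebra scalars A laurent_y_ring"
    and "extending A laurent_y_ring"
  shows "(\<exists>\<sigma> \<in> algebra_automorphisms scalars laurent_y_ring.
            generated_subalgebra scalars laurent_y_ring {var_t, var_y} \<subseteq> \<sigma> ` A)
         \<longleftrightarrow> \<not> generated_subalgebra scalars laurent_y_ring {var_t, var_t_inv} \<subseteq> A"
    (is "?i \<longleftrightarrow> \<not> ?ii")
proof -
  have max: "maximal_subring A laurent_y_ring" and alg: "subalgebra scalars A laurent_y_ring"
    using assms(1) by (auto simp: maximal_subalgebra_def)
  have A: "subring A laurent_y_ring" and ne: "A \<noteq> UNIV"
    using max by (auto simp: maximal_subring_def)
  note A' = A[unfolded subring_ring_of_type_algebra_iff]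
  have sc: "scalars \<subseteq> A"
  proof
    fix c :: "'k laurent_y" assume "c \<in> scalars"
    then show "c \<in> A" using subalgebra.smult_closed[OF alg, of c 1] A' by simp
  qed
  show ?thesis
  proof
    assume ?i
    then obtain \<sigma> where \<sigma>: "\<sigma> \<in> algebra_automorphisms scalars laurent_y_ring"
      and gen: "generated_subalgebra scalars laurent_y_ring {var_t, var_y} \<subseteq> \<sigma> ` A" by blast
    have hom: "\<sigma> (x * y) = \<sigma> x * \<sigma> y" "\<sigma> (x + y) = \<sigma> x + \<sigma> y" "\<sigma> 1 = 1" for x y
      using \<sigma> by (auto simp: algebra_automorphisms_def ring_iso_def ring_hom_def)
    have bij: "bij \<sigma>" using \<sigma> by (auto simp: algebra_automorphisms_def ring_iso_def)
    show "\<not> ?ii"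
    proof
      assume ii: ?ii
      \<comment> \<open>The preimage \<open>u\<close> of the inverse of \<open>t\<close> is a unit,
        hence of degree 0 in \<open>y\<close>, hence a Laurent polynomial in \<open>t\<close> and an
        element of \<open>A\<close>.\<close>
      obtain u v where uv: "\<sigma> u = var_t_inv" "\<sigma> v = var_t"
        using bij by (metis bij_pointE)
      then have "\<sigma> (v * u) = \<sigma> 1" by (simp add: hom var_t_mult_inv)
      then have "v * u = 1" using bij by (simp add: bij_is_inj inj_eq)
      moreover from this have "v \<noteq> 0" "u \<noteq> 0" by auto
      ultimately have "degree u = 0" using degree_mult_eq[of v u] by simp
      then have "u \<in> A"
        using ii by (auto simp: generated_subalgebra_t_inv elim: degree_eq_zeroE)
      then have tinv: "var_t_inv \<in> \<sigma> ` A" using uv by force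
      have tmem: "var_t \<in> \<sigma> ` A" "var_y \<in> \<sigma> ` A"
        using gen unfolding generated_subalgebra_def by (auto intro: generate_ring.incl)
      have const: "[:f:] \<in> \<sigma> ` A" for f
        using generated_subalgebra_subset_image[OF \<sigma> A sc, of "{var_t, var_t_inv}"] tinv tmem
        by (auto simp: generated_subalgebra_t_inv)
      \<comment> \<open>By Horner's scheme, the Laurent polynomials in \<open>t\<close> together
        with \<open>y\<close> yield every element, so \<open>\<sigma>\<close> maps \<open>A\<close>
        onto the whole ring, against properness of \<open>A\<close>.\<close>
      have "p \<in> \<sigma> ` A" for p
      proof (induction p)
        case 0
        show ?case using const[of 0] by simp
      next
        case (pCons a p)
        have "pCons a p = [:a:] + var_y * p" by (simp add: var_y_def)
        moreover obtain a' y' p' where "a' \<in> A" "y' \<in> A" "p' \<in> A" "\<sigma> a' = [:a:]" "\<sigma> y' = var_y" "\<sigma> p' = p"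
          using const[of a] tmem(2) pCons.IH by (metis imageE)
        ultimately have "pCons a p = \<sigma> (a' + y' * p')" "a' + y' * p' \<in> A"
          using A' by (auto simp: hom)
        then show ?case by blast
      qed
      then have "\<sigma> ` A = \<sigma> ` UNIV" using bij by (auto simp: bij_is_surj)
      then show False using bij ne by (simp add: bij_is_inj inj_image_eq_iff)
    qed
  next
    assume nii: "\<not> ?ii"
    let ?t = "Poly_Mapping.single 1 1 :: int \<Rightarrow>\<^sub>0 'k"
    let ?s = "Poly_Mapping.single (-1) 1 :: int \<Rightarrow>\<^sub>0 'k"
    have st: "?s * ?t = 1" "?t * ?s = 1" by (simp_all add: mult_single)
    have "\<not> {var_t, var_t_inv} \<subseteq> A"
    proof
      assume sub: "{var_t, var_t_inv} \<subseteq> A"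
      have "id \<in> algebra_automorphisms scalars (laurent_y_ring :: 'k laurent_y ring)"
        by (auto simp: algebra_automorphisms_def ring_iso_def ring_hom_def)
      from generated_subalgebra_subset_image[OF this A sc, of "{var_t, var_t_inv}"] sub nii
      show False by simp
    qed
    moreover have "var_t_inv \<in> A \<or> var_t \<in> A"
      by (rule maximal_extending_mem_or_inverse_mem[OF max assms(2) var_t_mult_inv])
    ultimately consider "var_t \<in> A" "var_t_inv \<notin> A" | "var_t_inv \<in> A" "var_t \<notin> A" by blast
    then show ?i
    proof cases
      case 1
      have "id \<in> algebra_automorphisms scalars (laurent_y_ring :: 'k laurent_y ring)"
        by (auto simp: algebra_automorphisms_def ring_iso_def ring_hom_def)
      from exists_automorphism[OF max sc this st(1)] 1 show ?thesis
        by (simp add: var_t_def var_t_inv_def)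
    next
      case 2
      \<comment> \<open>The roles of \<open>t\<close> and its inverse are exchanged. The flip sends
        the inverse of \<open>t\<close> to \<open>t\<close> and fixes \<open>y\<close>.\<close>
      from exists_automorphism[OF max sc map_poly_laurent_flip_automorphism st(2)] 2 show ?thesis
        by (simp add: var_t_def var_t_inv_def var_y_def map_poly_pCons)
    qed
  qed
qed

end
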